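(* Let $a,b,c\in\mathbb{R}$ with $a^2+b^2+c^2\neq0$, let $$\phi(t)=R(at)\oplus R(bt)\oplus R(ct)\in \mathsf{GL}(6,\mathbb{R}),\qquad R(\theta)=\begin{pmatrix}\cos\theta&-\sin\theta\\ \sin\theta&\cos\theta\end{pmatrix},$$ and let $t_0\in\mathbb{R}$. Then $\phi(t_0)$ is similar to an integer matrix if and only if, up to permuting $a,b,c$ and up to replacing each of the numbers $at_0,bt_0,ct_0$ (independently) by $2\pi k\pm$ itself for some $k\in\mathbb{Z}$, one of the following cases occurs: Case 1: $at_0,bt_0,ct_0\in\{2\pi,\pi,\frac{2\pi}{3},\frac{\pi}{2},\frac{\pi}{3}\}$. Case 2: $at_0\in\{2\pi,\pi,\frac{2\pi}{3},\frac{\pi}{2},\frac{\pi}{3}\}$ and $(bt_0,ct_0)\in\{(\frac{2\pi}{5},\frac{4\pi}{5}),(\frac{\pi}{4},\frac{3\pi}{4}),(\frac{\pi}{5},\frac{3\pi}{5}),(\frac{\pi}{6},\frac{5\pi}{6})\}$. Case 3: $(at_0,bt_0,ct_0)\in\{(\frac{2\pi}{7},\frac{4\pi}{7},\frac{6\pi}{7}),(\frac{2\pi}{9},\frac{4\pi}{9},\frac{8\pi}{9}),(\frac{2\pi}{14},\frac{6\pi}{14},\frac{10\pi}{14}),(\frac{2\pi}{18},\frac{10\pi}{18},\frac{14\pi}{18})\}$.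
   Context: $A\oplus B$ denotes the block-diagonal matrix with blocks $A,B$. A real $n\times n$ matrix $A$ is similar to $B$ if $P^{-1}AP=B$ for some $P\in\mathsf{GL}(n,\mathbb{R})$; an integer matrix is one with all entries in $\mathbb{Z}$. *)

theory Defs
  imports Complex_Main "Jordan_Normal_Form.Matrix"
begin

definition rot_mat :: "real \<Rightarrow> real mat" where
  "rot_mat \<theta> = mat_of_rows_list 2 [[cos \<theta>, - sin \<theta>], [sin \<theta>, cos \<theta>]]"

definition phi :: "real \<Rightarrow> real \<Rightarrow> real \<Rightarrow> real \<Rightarrow> real mat" where
  "phi a b c t = diag_block_mat [rot_mat (a * t), rot_mat (b * t), rot_mat (c * t)]"

lemma phi_carrier: "phi a b c t \<in> carrier_mat 6 6"
  by (rule carrier_matI) (simp_all add: phi_def rot_mat_def mat_of_rows_list_def Let_def)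

definition integer_mat :: "real mat \<Rightarrow> bool" where
  "integer_mat A \<longleftrightarrow> elements_mat A \<subseteq> \<int>"

definition angle_replacement :: "real \<Rightarrow> real \<Rightarrow> bool" where
  "angle_replacement x y \<longleftrightarrow> (\<exists>k::int. y = 2 * pi * of_int k + x \<or> y = 2 * pi * of_int k - x)"

definition base_angles :: "real set" where
  "base_angles = {2 * pi, pi, 2 * pi / 3, pi / 2, pi / 3}"

definition case1 :: "real \<Rightarrow> real \<Rightarrow> real \<Rightarrow> bool" where
  "case1 x y z \<longleftrightarrow> x \<in> base_angles \<and> y \<in> base_angles \<and> z \<in> base_angles"

definition case2 :: "real \<Rightarrow> real \<Rightarrow> real \<Rightarrow> bool" where
  "case2 x y z \<longleftrightarrow> x \<in> base_angles \<and>
     (y, z) \<in> {(2 * pi / 5, 4 * pi / 5), (pi / 4, 3 * pi / 4),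
               (pi / 5, 3 * pi / 5), (pi / 6, 5 * pi / 6)}"

definition case3 :: "real \<Rightarrow> real \<Rightarrow> real \<Rightarrow> bool" where
  "case3 x y z \<longleftrightarrow>
     (x, y, z) \<in> {(2 * pi / 7, 4 * pi / 7, 6 * pi / 7),
                  (2 * pi / 9, 4 * pi / 9, 8 * pi / 9),
                  (2 * pi / 14, 6 * pi / 14, 10 * pi / 14),
                  (2 * pi / 18, 10 * pi / 18, 14 * pi / 18)}"

end

theory Submission
  imports Defs "Jordan_Normal_Form.Char_Poly"
begin

text \<open>Put \<open>u = 2 cos (a t\<^sub>0)\<close>, \<open>v = 2 cos (b t\<^sub>0)\<close>, \<open>w = 2 cos (c t\<^sub>0)\<close>. The characteristic polynomial of
  \<open>\<phi>(t\<^sub>0)\<close> is \<open>(x\<^sup>2 - u x + 1) (x\<^sup>2 - v x + 1) (x\<^sup>2 - w x + 1)\<close>, so similarity to an integer matrix forces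
  the elementary symmetric functions of \<open>u, v, w\<close> to be integers. As \<open>u, v, w\<close> lie in \<open>[-2, 2]\<close>, only
  finitely many cubics remain; the nonnegativity of the discriminant and of the elementary symmetric
  functions of \<open>2 - u, \<dots>\<close> and \<open>2 + u, \<dots>\<close> leaves exactly those with the listed roots.

  Conversely, on \<open>\<real>[X]/(X\<^sup>2 - u X + 1) \<oplus> \<dots>\<close> the operator \<open>T = X + X\<^sup>-\<^sup>1\<close> has eigenvalues \<open>u, \<dots>\<close>. When
  these are distinct and \<open>w\<^sub>0\<close> is a cyclic vector, \<open>X\<close> has an integer matrix in the basis
  \<open>w\<^sub>0, X w\<^sub>0, T w\<^sub>0, X T w\<^sub>0, \<dots>\<close>.\<close>

section \<open>Similarity of block-diagonal matrices\<close>

text \<open>Conjugation by the block permutation matrix \<open>?P\<close> exchanges the two diagonal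
  blocks; its inverse \<open>?Q\<close> is the same pattern with the sizes swapped.\<close>

lemma similar_mat_four_block_swap:
  fixes A B :: "'a :: comm_ring_1 mat"
  assumes A: "A \<in> carrier_mat n n" and B: "B \<in> carrier_mat m m"
  shows "similar_mat (four_block_mat A (0\<^sub>m n m) (0\<^sub>m m n) B) (four_block_mat B (0\<^sub>m m n) (0\<^sub>m n m) A)"
proof -
  let ?P = "four_block_mat (0\<^sub>m n m) (1\<^sub>m n) (1\<^sub>m m) (0\<^sub>m m n) :: 'a mat"
  let ?Q = "four_block_mat (0\<^sub>m m n) (1\<^sub>m m) (1\<^sub>m n) (0\<^sub>m n m) :: 'a mat"
  let ?AB = "four_block_mat A (0\<^sub>m n m) (0\<^sub>m m n) B"
  let ?BA = "four_block_mat B (0\<^sub>m m n) (0\<^sub>m n m) A"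
  have "?P * ?BA = four_block_mat (0\<^sub>m n m) A B (0\<^sub>m m n)"
    using A B by (subst mult_four_block_mat[of _ n m _ n _ m _ _ m _ n]) auto
  moreover have "four_block_mat (0\<^sub>m n m) A B (0\<^sub>m m n) * ?Q = ?AB"
    using A B by (subst mult_four_block_mat[of _ n m _ n _ m _ _ n _ m]) auto
  ultimately have "?AB = ?P * ?BA * ?Q" by simp
  moreover have "?P * ?Q = 1\<^sub>m (n + m)"
    by (subst mult_four_block_mat[of _ n m _ n _ m _ _ n _ m]) (auto intro: eq_matI)
  moreover have "?Q * ?P = 1\<^sub>m (n + m)"
    by (subst mult_four_block_mat[of _ m n _ m _ n _ _ m _ n]) (auto intro: eq_matI)
  moreover have "?P \<in> carrier_mat (n + m) (n + m)" "?Q \<in> carrier_mat (n + m) (n + m)"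
    "?BA \<in> carrier_mat (n + m) (n + m)" "?AB \<in> carrier_mat (n + m) (n + m)"
    using A B by (auto simp: add.commute intro: carrier_matI)
  ultimately show ?thesis by (intro similar_matI[of _ _ ?P ?Q "n + m"]) auto
qed

lemma diag_block_mat_carrier:
  assumes "\<And>A. A \<in> set As \<Longrightarrow> square_mat A"
  obtains n where "diag_block_mat As \<in> carrier_mat n n"
proof -
  have "square_mat (diag_block_mat As)" by (rule diag_block_mat_square) (use assms in blast)
  then have "dim_col (diag_block_mat As) = dim_row (diag_block_mat As)" by (simp only: square_mat.simps)
  then have "diag_block_mat As \<in> carrier_mat (dim_row (diag_block_mat As)) (dim_row (diag_block_mat As))"
    by (rule carrier_matI[OF refl])
  then show ?thesis by (rule that)
qed

lemma similar_mat_diag_block_Cons: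
  assumes "similar_mat A B" "similar_mat (diag_block_mat As) (diag_block_mat Bs)"
  shows "similar_mat (diag_block_mat (A # As)) (diag_block_mat (B # Bs))"
proof -
  obtain n where "A \<in> carrier_mat n n" "B \<in> carrier_mat n n" using similar_matD[OF assms(1)] by auto
  moreover obtain m where "diag_block_mat As \<in> carrier_mat m m" "diag_block_mat Bs \<in> carrier_mat m m"
    using similar_matD[OF assms(2)] by auto
  ultimately show ?thesis using similar_mat_four_block_0_0[OF assms] by (simp add: Let_def)
qed

lemma similar_mat_diag_block_append_swap:
  fixes As Bs :: "'a :: comm_ring_1 mat list"
  assumes "\<And>A. A \<in> set (As @ Bs) \<Longrightarrow> square_mat A"
  shows "similar_mat (diag_block_mat (As @ Bs)) (diag_block_mat (Bs @ As))"
proof -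
  obtain n where A: "diag_block_mat As \<in> carrier_mat n n"
    by (rule diag_block_mat_carrier[of As]) (use assms in auto)
  obtain m where B: "diag_block_mat Bs \<in> carrier_mat m m"
    by (rule diag_block_mat_carrier[of Bs]) (use assms in auto)
  show ?thesis
    using similar_mat_four_block_swap[OF A B]
    unfolding diag_block_mat_append Let_def carrier_matD[OF A] carrier_matD[OF B] .
qed

text \<open>This makes the order of the rotation blocks irrelevant. Induction: the head
  \<open>A\<close> occurs in \<open>Bs\<close> as \<open>Bs1 @ A # Bs2\<close>, and a block swap
  rotates that list to \<open>A # Bs2 @ Bs1\<close>.\<close>

lemma similar_mat_diag_block_mset:
  fixes As Bs :: "'a :: comm_ring_1 mat list"
  assumes "mset As = mset Bs" "\<And>A. A \<in> set As \<Longrightarrow> square_mat A"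
  shows "similar_mat (diag_block_mat As) (diag_block_mat Bs)"
  using assms
proof (induction As arbitrary: Bs)
  case Nil
  then show ?case using similar_mat_refl[of "0\<^sub>m 0 0 :: 'a mat" 0] by simp
next
  case (Cons A As)
  then have "A \<in> set Bs" by (metis list.set_intros(1) set_mset_mset)
  then obtain Bs1 Bs2 where Bs: "Bs = Bs1 @ A # Bs2" by (meson split_list)
  then have m: "mset As = mset (Bs2 @ Bs1)" using Cons.prems by simp
  have sq: "square_mat C" if "C \<in> set ((A # Bs2) @ Bs1)" for C
    using that Cons.prems(2) mset_eq_setD[OF m] by auto
  have "square_mat A" using Cons.prems(2) by simp
  then have "similar_mat A A" by (metis carrier_matI similar_mat_refl square_mat.simps)
  then have "similar_mat (diag_block_mat (A # As)) (diag_block_mat (A # (Bs2 @ Bs1)))"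
    by (rule similar_mat_diag_block_Cons) (use Cons.IH[OF m] Cons.prems(2) in auto)
  then have "similar_mat (diag_block_mat (A # As)) (diag_block_mat ((A # Bs2) @ Bs1))"
    by (simp only: append_Cons)
  moreover have "similar_mat (diag_block_mat ((A # Bs2) @ Bs1)) (diag_block_mat Bs)"
    using similar_mat_diag_block_append_swap[OF sq] unfolding Bs .
  ultimately show ?case by (rule similar_mat_trans)
qed

text \<open>The matrix whose determinant is the characteristic polynomial is again block-diagonal,
  so the determinant factors.\<close>

lemma char_poly_four_block_diag:
  fixes A B :: "'a :: idom mat"
  assumes A: "A \<in> carrier_mat n n" and B: "B \<in> carrier_mat m m"
  shows "char_poly (four_block_mat A (0\<^sub>m n m) (0\<^sub>m m n) B) = char_poly A * char_poly B"
proof -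
  have "char_poly_matrix (four_block_mat A (0\<^sub>m n m) (0\<^sub>m m n) B) =
      four_block_mat (char_poly_matrix A) (0\<^sub>m n m) (0\<^sub>m m n) (char_poly_matrix B)"
    using A B by (intro eq_matI) (auto simp: char_poly_matrix_def)
  then show ?thesis unfolding char_poly_def
    using A B by (simp add: det_four_block_mat_lower_left_zero[of _ n _ m])
qed

lemma char_poly_diag_block_mat:
  fixes As :: "'a :: idom mat list"
  assumes "\<And>A. A \<in> set As \<Longrightarrow> square_mat A"
  shows "char_poly (diag_block_mat As) = prod_list (map char_poly As)"
  using assms
proof (induction As)
  case Nil
  show ?case by (simp add: char_poly_def char_poly_matrix_def)
next
  case (Cons A As)
  have "square_mat A" using Cons.prems by simp
  then obtain n where A: "A \<in> carrier_mat n n" by (metis carrier_matI square_mat.simps)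
  obtain m where D: "diag_block_mat As \<in> carrier_mat m m"
    by (rule diag_block_mat_carrier[of As]) (use Cons.prems in auto)
  show ?case using char_poly_four_block_diag[OF A D] Cons.IH Cons.prems carrier_matD[OF A] carrier_matD[OF D]
    by (simp add: Let_def del: square_mat.simps)
qed

section \<open>Integrality of the symmetric functions of the cosines\<close>

lemma rot_mat_carrier: "rot_mat \<theta> \<in> carrier_mat 2 2"
  by (rule carrier_matI) (simp_all add: rot_mat_def mat_of_rows_list_def)

lemma det_2:
  assumes "A \<in> carrier_mat 2 2"
  shows "det A = A $$ (0, 0) * A $$ (1, 1) - A $$ (0, 1) * A $$ (1, 0)"
proof -
  have "mat_delete A i 0 \<in> carrier_mat 1 1" for i using assms mat_delete_carrier[of A 2 2 i 0] by simp
  then show ?thesis using assms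
    by (simp add: laplace_expansion_column[OF assms, of 0] cofactor_def numeral_2_eq_2
       det_single mat_delete_def)
qed

lemma char_poly_rot_mat: "char_poly (rot_mat \<theta>) = [:1, - (2 * cos \<theta>), 1:]"
proof -
  have "char_poly (rot_mat \<theta>) = [:- cos \<theta>, 1:] * [:- cos \<theta>, 1:] + [:sin \<theta>:] * [:sin \<theta>:]"
    unfolding char_poly_def
    by (subst det_2[OF char_poly_matrix_closed[OF rot_mat_carrier]])
      (simp add: char_poly_matrix_def rot_mat_def mat_of_rows_list_def)
  moreover have "cos \<theta> * cos \<theta> + sin \<theta> * sin \<theta> = 1"
    using sin_cos_squared_add3[of \<theta>] by simp
  ultimately show ?thesis by simp
qed

text \<open>The characteristic polynomial commutes with the ring homomorphism \<open>of_int\<close>,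
  so it is the image of a polynomial over the integers.\<close>

lemma integer_mat_char_poly_coeff:
  assumes "integer_mat B" "B \<in> carrier_mat n n"
  shows "coeff (char_poly B) i \<in> \<int>"
proof -
  \<comment> \<open>On integer entries \<open>floor\<close> is a genuine inverse of
    \<open>of_int\<close>, so \<open>C\<close> is an integer-typed copy of \<open>B\<close>.\<close>
  define C where "C = map_mat floor B"
  have B: "B = map_mat of_int C"
  proof (rule eq_matI)
    fix i j assume "i < dim_row (map_mat of_int C :: real mat)" "j < dim_col (map_mat of_int C :: real mat)"
    then have ij: "i < dim_row B" "j < dim_col B" by (auto simp: C_def)
    then have "B $$ (i, j) \<in> elements_mat B" by (intro elements_matI[of B "dim_row B" "dim_col B" i j]) auto
    then have "B $$ (i, j) \<in> \<int>" using assms(1) unfolding integer_mat_def by blast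
    then show "B $$ (i, j) = map_mat of_int C $$ (i, j)" using ij by (auto simp: C_def elim: Ints_cases)
  qed (simp_all add: C_def)
  have "C \<in> carrier_mat n n" using assms(2) by (simp add: C_def)
  then show ?thesis unfolding B using of_int_hom.char_poly_hom[of C n, where ?'a = real] by simp
qed

text \<open>The product is palindromic. Its coefficients -e1, 3 + e2 and -(2 e1 + e3) determine the
  elementary symmetric functions e1, e2, e3 of \<open>u\<close>, \<open>v\<close>, \<open>w\<close>
  by integer operations.\<close>

lemma product_of_reciprocal_quadratics:
  fixes u v w :: "'a :: comm_ring_1"
  shows "[:1, - u, 1:] * ([:1, - v, 1:] * [:1, - w, 1:]) =
    [:1, - (u + v + w), 3 + (u * v + v * w + w * u),
      - (2 * (u + v + w) + u * v * w), 3 + (u * v + v * w + w * u), - (u + v + w), 1:]"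
  by (simp add: algebra_simps)

lemma similar_integer_imp_symmetric_integers:
  assumes sim: "similar_mat (phi a b c t) B" and B: "integer_mat B"
  defines "u \<equiv> 2 * cos (a * t)" and "v \<equiv> 2 * cos (b * t)" and "w \<equiv> 2 * cos (c * t)"
  shows "u + v + w \<in> \<int>" "u * v + v * w + w * u \<in> \<int>" "u * v * w \<in> \<int>"
proof -
  have "B \<in> carrier_mat 6 6"
    using similar_matD[OF sim] phi_carrier[of a b c t] by auto
  then have int: "coeff (char_poly (phi a b c t)) i \<in> \<int>" for i
    using char_poly_similar[OF sim] integer_mat_char_poly_coeff[OF B] by simp
  have "char_poly (phi a b c t) = [:1, - u, 1:] * ([:1, - v, 1:] * [:1, - w, 1:])"
    unfolding phi_def
    by (subst char_poly_diag_block_mat)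
      (auto simp: char_poly_rot_mat u_def v_def w_def carrier_matD[OF rot_mat_carrier])
  also have "\<dots> = [:1, - (u + v + w), 3 + (u * v + v * w + w * u),
      - (2 * (u + v + w) + u * v * w), 3 + (u * v + v * w + w * u), - (u + v + w), 1:]"
    by (rule product_of_reciprocal_quadratics)
  finally have p: "char_poly (phi a b c t) = \<dots>" .
  have *: "- (u + v + w) \<in> \<int>" "3 + (u * v + v * w + w * u) \<in> \<int>"
    "- (2 * (u + v + w) + u * v * w) \<in> \<int>"
    using int[of 1] int[of 2] int[of 3]
    unfolding p One_nat_def numeral_2_eq_2 numeral_3_eq_3 coeff_pCons_Suc coeff_pCons_0 .
  from *(1) show 1: "u + v + w \<in> \<int>" unfolding minus_in_Ints_iff .
  have "(3 + (u * v + v * w + w * u)) - 3 \<in> \<int>" by (intro Ints_diff * Ints_numeral)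
  then show "u * v + v * w + w * u \<in> \<int>" by (simp only: add_diff_cancel_left')
  have "2 * (u + v + w) + u * v * w - 2 * (u + v + w) \<in> \<int>"
    using *(3) 1 unfolding minus_in_Ints_iff by (intro Ints_diff Ints_mult Ints_numeral)
  then show "u * v * w \<in> \<int>" by (simp only: add_diff_cancel_left')
qed

section \<open>Integer models of sums of rotations\<close>

text \<open>For explicit matrices the equation \<open>A * P = P * B\<close> is easier to check
  entrywise than a conjugation, and over a field a one-sided inverse is two-sided.\<close>

lemma similar_matI_intertwine:
  fixes A :: "'a :: field mat"
  assumes A: "A \<in> carrier_mat n n" and B: "B \<in> carrier_mat n n"
    and P: "P \<in> carrier_mat n n" and Q: "Q \<in> carrier_mat n n"
    and inv: "P * Q = 1\<^sub>m n" and int: "A * P = P * B"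
  shows "similar_mat A B"
proof (rule similar_matI[of _ _ P Q n])
  show "Q * P = 1\<^sub>m n" using mat_mult_left_right_inverse[OF P Q inv] .
  have "A = A * (P * Q)" using A by (simp add: inv)
  also have "\<dots> = P * B * Q" using assoc_mult_mat[OF A P Q] int by simp
  finally show "A = P * B * Q" .
qed (use assms in auto)

lemma integer_matI:
  "(\<And>i j. i < dim_row A \<Longrightarrow> j < dim_col A \<Longrightarrow> A $$ (i, j) \<in> \<int>) \<Longrightarrow> integer_mat A"
  unfolding integer_mat_def by (auto dest!: elements_matD)

lemma integer_diag_block_mat:
  assumes "\<And>A. A \<in> set As \<Longrightarrow> integer_mat A"
  shows "integer_mat (diag_block_mat As)"
proof -
  have "\<Union> (set (map elements_mat As)) \<subseteq> \<int>" using assms unfolding integer_mat_def by auto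
  then have "{0} \<union> \<Union> (set (map elements_mat As)) \<subseteq> \<int>" by simp
  then show ?thesis using elements_diag_block_mat[of As] unfolding integer_mat_def by (rule subset_trans[rotated])
qed

text \<open>Multiplication by X on the quotient of the real polynomials by X^2 - u X + 1, in the
  basis 1, X.\<close>

definition companion2 :: "real \<Rightarrow> real mat" where
  "companion2 u = mat_of_rows_list 2 [[0, -1], [1, u]]"

lemmas explicit_mat_simps = mat_of_rows_list_def scalar_prod_def Let_def numeral_eq_Suc
  less_Suc_eq sum.atLeast0_lessThan_Suc

lemma companion2_carrier: "companion2 u \<in> carrier_mat 2 2"
  by (rule carrier_matI) (simp_all add: companion2_def mat_of_rows_list_def)

text \<open>The columns of \<open>?P\<close> are the first unit vector and its rotated image. They
  form a basis because the sine is nonzero.\<close>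

lemma similar_rot_mat_companion2:
  assumes "sin \<theta> \<noteq> 0"
  shows "similar_mat (rot_mat \<theta>) (companion2 (2 * cos \<theta>))"
proof (rule similar_matI_intertwine[OF rot_mat_carrier companion2_carrier])
  let ?P = "mat_of_rows_list 2 [[1, cos \<theta>], [0, sin \<theta>]]"
  let ?Q = "mat_of_rows_list 2 [[1, - cos \<theta> / sin \<theta>], [0, 1 / sin \<theta>]]"
  show "?P \<in> carrier_mat 2 2" "?Q \<in> carrier_mat 2 2"
    by (rule carrier_matI; simp add: mat_of_rows_list_def)+
  show "?P * ?Q = 1\<^sub>m 2" using assms by (intro eq_matI) (auto simp: explicit_mat_simps)
  have "sin \<theta> * sin \<theta> = 1 - cos \<theta> * cos \<theta>" using sin_cos_squared_add3[of \<theta>] by linarith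
  then show "rot_mat \<theta> * ?P = ?P * companion2 (2 * cos \<theta>)"
    by (intro eq_matI) (auto simp: rot_mat_def companion2_def explicit_mat_simps algebra_simps)
qed

text \<open>The operator X in the basis w0, X w0, T w0, X T w0, where T = X + X^-1 satisfies T^2 = p
  T - q. The columns follow from X^2 = X T - 1; for instance X (X T w0) = p X T w0 - q X w0 - T
  w0.\<close>

definition companion4 :: "real \<Rightarrow> real \<Rightarrow> real mat" where
  "companion4 p q = mat_of_rows_list 4
     [[0, -1, 0, 0],
      [1, 0, 0, -q],
      [0, 0, 0, -1],
      [0, 1, 1, p]]"

lemma companion4_carrier: "companion4 p q \<in> carrier_mat 4 4"
  by (rule carrier_matI) (simp_all add: companion4_def mat_of_rows_list_def)

lemma diag_companion2_pair:
  "diag_block_mat [companion2 u, companion2 v] = mat_of_rows_list 4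
     [[0, -1, 0, 0],
      [1, u, 0, 0],
      [0, 0, 0, -1],
      [0, 0, 1, v]]"
  by (intro eq_matI) (auto simp: companion2_def explicit_mat_simps)

lemma similar_diag_companion2_companion4:
  assumes "u \<noteq> v"
  shows "similar_mat (diag_block_mat [companion2 u, companion2 v]) (companion4 (u + v) (u * v))"
proof (rule similar_matI_intertwine[OF _ companion4_carrier])
  define r where "r = 1 / (v - u)"
  have r: "r * (v - u) = 1" using assms by (simp add: r_def)
  \<comment> \<open>\<open>?P\<close> is the Vandermonde matrix of \<open>u\<close>,
    \<open>v\<close> with each entry inflated to a multiple of the 2 x 2 identity; its columns are
    w0, X w0, T w0, X T w0 with w0 = (1, 0, 1, 0). \<open>?Q\<close> inflates the inverse
    Vandermonde matrix.\<close>
  let ?P = "mat_of_rows_list 4 [[1, 0, u, 0], [0, 1, 0, u], [1, 0, v, 0], [0, 1, 0, v]]"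
  let ?Q = "mat_of_rows_list 4 [[v * r, 0, - u * r, 0], [0, v * r, 0, - u * r], [- r, 0, r, 0], [0, - r, 0, r]]"
  show "diag_block_mat [companion2 u, companion2 v] \<in> carrier_mat 4 4"
    by (rule carrier_matI) (simp_all only: diag_companion2_pair, simp_all add: mat_of_rows_list_def)
  show "?P \<in> carrier_mat 4 4" "?Q \<in> carrier_mat 4 4"
    by (rule carrier_matI; simp add: mat_of_rows_list_def)+
  show "?P * ?Q = 1\<^sub>m 4" using r by (intro eq_matI) (auto simp: explicit_mat_simps algebra_simps)
  show "diag_block_mat [companion2 u, companion2 v] * ?P = ?P * companion4 (u + v) (u * v)"
    unfolding diag_companion2_pair companion4_def
    by (intro eq_matI) (auto simp: explicit_mat_simps algebra_simps)
qed

text \<open>As for \<open>companion4\<close>, with basis w0, X w0, T w0, X T w0, T^2 w0, X T^2 w0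
  and T^3 = p T^2 - q T + r.\<close>

definition companion6 :: "real \<Rightarrow> real \<Rightarrow> real \<Rightarrow> real mat" where
  "companion6 p q r = mat_of_rows_list 6
     [[0, -1, 0, 0, 0, 0],
      [1, 0, 0, 0, 0, r],
      [0, 0, 0, -1, 0, 0],
      [0, 1, 1, 0, 0, -q],
      [0, 0, 0, 0, 0, -1],
      [0, 0, 0, 1, 1, p]]"

lemma companion6_carrier: "companion6 p q r \<in> carrier_mat 6 6"
  by (rule carrier_matI) (simp_all add: companion6_def mat_of_rows_list_def)

lemma diag_companion2_triple:
  "diag_block_mat [companion2 u, companion2 v, companion2 w] = mat_of_rows_list 6
     [[0, -1, 0, 0, 0, 0],
      [1, u, 0, 0, 0, 0],
      [0, 0, 0, -1, 0, 0],
      [0, 0, 1, v, 0, 0],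
      [0, 0, 0, 0, 0, -1],
      [0, 0, 0, 0, 1, w]]"
  by (intro eq_matI) (auto simp: companion2_def explicit_mat_simps)

lemma similar_diag_companion2_companion6:
  assumes "u \<noteq> v" "v \<noteq> w" "w \<noteq> u"
  shows "similar_mat (diag_block_mat [companion2 u, companion2 v, companion2 w])
    (companion6 (u + v + w) (u * v + v * w + w * u) (u * v * w))"
proof (rule similar_matI_intertwine[OF _ companion6_carrier])
  define a b c where abc: "a = 1 / ((u - v) * (u - w))" "b = 1 / ((v - u) * (v - w))" "c = 1 / ((w - u) * (w - v))"
  have inv: "a * ((u - v) * (u - w)) = 1" "b * ((v - u) * (v - w)) = 1" "c * ((w - u) * (w - v)) = 1"
    using assms by (simp_all add: abc)
  let ?P = "mat_of_rows_list 6
    [[1, 0, u, 0, u * u, 0], [0, 1, 0, u, 0, u * u],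
     [1, 0, v, 0, v * v, 0], [0, 1, 0, v, 0, v * v],
     [1, 0, w, 0, w * w, 0], [0, 1, 0, w, 0, w * w]]"
  \<comment> \<open>The inverse Vandermonde matrix holds the coefficients of the Lagrange basis
    polynomials, e.g. a (x - v) (x - w); \<open>a\<close>, \<open>b\<close>, \<open>c\<close> are
    their normalising factors.\<close>
  let ?Q = "mat_of_rows_list 6
    [[v * w * a, 0, w * u * b, 0, u * v * c, 0],
     [0, v * w * a, 0, w * u * b, 0, u * v * c],
     [- (v + w) * a, 0, - (w + u) * b, 0, - (u + v) * c, 0],
     [0, - (v + w) * a, 0, - (w + u) * b, 0, - (u + v) * c],
     [a, 0, b, 0, c, 0],
     [0, a, 0, b, 0, c]]"
  show "diag_block_mat [companion2 u, companion2 v, companion2 w] \<in> carrier_mat 6 6"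
    by (rule carrier_matI) (simp_all only: diag_companion2_triple, simp_all add: mat_of_rows_list_def)
  show "?P \<in> carrier_mat 6 6" "?Q \<in> carrier_mat 6 6"
    by (rule carrier_matI; simp add: mat_of_rows_list_def)+
  show "?P * ?Q = 1\<^sub>m 6" using inv by (intro eq_matI) (auto simp: explicit_mat_simps algebra_simps)
  show "diag_block_mat [companion2 u, companion2 v, companion2 w] * ?P =
      ?P * companion6 (u + v + w) (u * v + v * w + w * u) (u * v * w)"
    unfolding diag_companion2_triple companion6_def
    by (intro eq_matI) (auto simp: explicit_mat_simps algebra_simps)
qed

section \<open>Elementary symmetric functions\<close>

text \<open>HOL-Algebra shadows the method name \<open>algebra\<close>, hence the qualified \<open>Groebner_Basis.algebra\<close>.\<close>

lemma mset_pair_eq_of_sum_prod: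
  fixes u v a b :: real
  assumes "u + v = a + b" "u * v = a * b"
  shows "mset [u, v] = mset [a, b]"
proof -
  have "(u - a) * (u - b) = 0" using assms by Groebner_Basis.algebra
  then show ?thesis using assms(1) by (auto simp: add_mset_commute)
qed

text \<open>\<open>u\<close> is a root of the cubic with roots \<open>a\<close>, \<open>b\<close>,
  \<open>c\<close>. Once it is matched with one of them, the remaining pairs share sum and product;
  cyclic rotation covers the three choices.\<close>

lemma mset_triple_eq_of_elementary_symmetric:
  fixes u v w a b c :: real
  assumes "u + v + w = a + b + c" "u * v + v * w + w * u = a * b + b * c + c * a"
    "u * v * w = a * b * c"
  shows "mset [u, v, w] = mset [a, b, c]"
proof -
  have step: "mset [u, v, w] = mset [a', b', c']"
    if u: "u = a'" and s: "u + v + w = a' + b' + c'"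
      "u * v + v * w + w * u = a' * b' + b' * c' + c' * a'" for a' b' c'
  proof -
    have "v + w = b' + c'" using u s by simp
    moreover have "v * w = b' * c'"
    proof -
      have "v * w = (u * v + v * w + w * u) - u * (u + v + w - u)" by (simp add: algebra_simps)
      also have "\<dots> = b' * c'" unfolding s unfolding u by (simp add: algebra_simps)
      finally show ?thesis .
    qed
    ultimately show ?thesis using mset_pair_eq_of_sum_prod[of v w b' c'] u by simp
  qed
  have "(u - a) * (u - b) * (u - c) = 0" using assms by Groebner_Basis.algebra
  then consider "u = a" | "u = b" | "u = c" by auto
  then show ?thesis
  proof cases
    case 1
    then show ?thesis using step[of a b c] assms by simp
  next
    case 2
    then have "mset [u, v, w] = mset [b, c, a]" using step[of b c a] assms by (simp add: algebra_simps)
    then show ?thesis by (simp add: add_mset_commute)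
  next
    case 3
    then have "mset [u, v, w] = mset [c, a, b]" using step[of c a b] assms by (simp add: algebra_simps)
    then show ?thesis by (simp add: add_mset_commute)
  qed
qed

lemma viete_two:
  fixes a b p q :: real
  assumes "a * a - p * a + q = 0" "b * b - p * b + q = 0" "a \<noteq> b"
  shows "a + b = p" "a * b = q"
proof -
  have "(a - b) * (a + b - p) = 0" using assms(1,2) by Groebner_Basis.algebra
  with \<open>a \<noteq> b\<close> show s: "a + b = p" by simp
  have "q = p * a - a * a" using assms(1) by simp
  then show "a * b = q" unfolding s[symmetric] by (simp add: algebra_simps)
qed

text \<open>Divided differences: subtracting two cubic equations and cancelling the difference of
  their roots gives quadratic relations, and repeating this gives the sum. The other coefficients
  follow by back substitution.\<close>

lemma viete_three:
  fixes a b c e1 e2 e3 :: real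
  assumes "a ^ 3 - e1 * a ^ 2 + e2 * a - e3 = 0" "b ^ 3 - e1 * b ^ 2 + e2 * b - e3 = 0"
    "c ^ 3 - e1 * c ^ 2 + e2 * c - e3 = 0" "a \<noteq> b" "b \<noteq> c" "c \<noteq> a"
  shows "a + b + c = e1" "a * b + b * c + c * a = e2" "a * b * c = e3"
proof -
  have 1: "(a - b) * (a * a + a * b + b * b - e1 * (a + b) + e2) = 0" using assms(1,2) by Groebner_Basis.algebra
  have 2: "(b - c) * (b * b + b * c + c * c - e1 * (b + c) + e2) = 0" using assms(2,3) by Groebner_Basis.algebra
  have 3: "a * a + a * b + b * b - e1 * (a + b) + e2 = 0" using 1 assms by simp
  have 4: "b * b + b * c + c * c - e1 * (b + c) + e2 = 0" using 2 assms by simp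
  have "(a - c) * (a + b + c - e1) = 0" using 3 4 by Groebner_Basis.algebra
  then show s: "a + b + c = e1" using assms by simp
  have "e2 = e1 * (a + b) - (a * a + a * b + b * b)" using 3 by simp
  then show t: "a * b + b * c + c * a = e2" unfolding s[symmetric] by (simp add: algebra_simps)
  have "e3 = a ^ 3 - e1 * a ^ 2 + e2 * a" using assms(1) by simp
  then show "a * b * c = e3" unfolding s[symmetric] t[symmetric]
    by (simp add: algebra_simps power2_eq_square power3_eq_cube)
qed

section \<open>The values of the cosines\<close>

lemma two_cos_double: "2 * cos (2 * x) = (2 * cos x)\<^sup>2 - (2::real)"
  by (simp add: cos_double_cos power2_eq_square)

lemma two_cos_triple: "2 * cos (3 * x) = (2 * cos x) ^ 3 - 3 * (2 * cos (x::real))"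
  by (simp add: cos_treble_cos power3_eq_cube)

lemma cos_ne_on_0_pi: "\<lbrakk>0 \<le> x; x \<le> pi; 0 \<le> y; y \<le> pi; x \<noteq> y\<rbrakk> \<Longrightarrow> cos x \<noteq> cos (y :: real)"
  using cos_inj_pi by auto

lemma cos_add_two_pi_int: "cos (2 * pi * of_int k + x) = cos x"
  using sin_cos_eq_iff[of "2 * pi * of_int k + x" x] by auto

lemma cos_diff_two_pi_int: "cos (2 * pi * of_int k - x) = cos x"
  using cos_add_two_pi_int[of k "-x"] by simp

text \<open>Reduces the permitted angle changes to cosines. Equal cosines force sines equal up to
  sign, and the two signs yield the two forms of replacement.\<close>

lemma angle_replacement_iff_cos_eq: "angle_replacement x y \<longleftrightarrow> cos x = cos y"
proof
  show "angle_replacement x y \<Longrightarrow> cos x = cos y"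
    by (auto simp: angle_replacement_def cos_add_two_pi_int cos_diff_two_pi_int)
next
  assume c: "cos x = cos y"
  then have "(sin y)\<^sup>2 = (sin x)\<^sup>2" by (simp add: sin_squared_eq)
  then consider "sin y = sin x" | "sin y = sin (- x)" by (auto simp: power2_eq_iff)
  then show "angle_replacement x y"
  proof cases
    case 1
    then obtain n :: int where "y = x + 2 * pi * n" using c sin_cos_eq_iff[of y x] by auto
    then show ?thesis unfolding angle_replacement_def by (intro exI[of _ n]) simp
  next
    case 2
    then obtain n :: int where "y = - x + 2 * pi * n" using c sin_cos_eq_iff[of y "-x"] by auto
    then show ?thesis unfolding angle_replacement_def by (intro exI[of _ n]) simp
  qed
qed

text \<open>For \<open>\<theta> = 2 \<pi> j / 7\<close> the relation \<open>cos (3 \<theta>) = cos (4 \<theta>)\<close> becomes a quartic in \<open>2 cos \<theta>\<close> that is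
  divisible by \<open>2 cos \<theta> - 2\<close>; similarly for \<open>2 \<pi> j / 5\<close> with \<open>cos (2 \<theta>) = cos (3 \<theta>)\<close>.\<close>

lemma two_cos_seventh:
  fixes t :: real and j :: int
  assumes t: "7 * t = 2 * pi * of_int j" and ne: "cos t \<noteq> 1"
  defines "z \<equiv> 2 * cos t"
  shows "z ^ 3 - (-1) * z ^ 2 + (-2) * z - 1 = 0"
proof -
  have "3 * t = 2 * pi * of_int j - 4 * t" using t by simp
  then have "cos (3 * t) = cos (2 * (2 * t))" using cos_diff_two_pi_int[of j "4 * t"]
    by (metis mult.assoc mult_2 numeral_Bit0 numeral_times_numeral semiring_norm(13))
  then have "z ^ 3 - 3 * z = (z\<^sup>2 - 2)\<^sup>2 - 2"
    using two_cos_triple[of t] two_cos_double[of t] two_cos_double[of "2 * t"] by (simp add: z_def)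
  then have "(z - 2) * (z ^ 3 - (-1) * z ^ 2 + (-2) * z - 1) = 0" by Groebner_Basis.algebra
  then show ?thesis using ne by (simp add: z_def)
qed

lemma two_cos_fifth:
  fixes t :: real and j :: int
  assumes t: "5 * t = 2 * pi * of_int j" and ne: "cos t \<noteq> 1"
  defines "z \<equiv> 2 * cos t"
  shows "z * z - (-1) * z + (-1) = 0"
proof -
  have "3 * t = 2 * pi * of_int j - 2 * t" using t by simp
  then have "cos (3 * t) = cos (2 * t)" using cos_diff_two_pi_int[of j "2 * t"] by presburger
  then have "z ^ 3 - 3 * z = z\<^sup>2 - 2"
    using two_cos_triple[of t] two_cos_double[of t] by (simp add: z_def)
  then have "(z - 2) * (z * z - (-1) * z + (-1)) = 0" by Groebner_Basis.algebra
  then show ?thesis using ne by (simp add: z_def)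
qed

lemma cos_ne_one: "0 < x \<Longrightarrow> x \<le> pi \<Longrightarrow> cos x \<noteq> 1"
  using cos_inj_pi[of x 0] by auto

text \<open>The triple-angle formula, with the coefficients spelled out in the shape that
  \<open>viete_three\<close> expects.\<close>

lemma two_cos_ninth:
  assumes "cos (3 * t) = e / 2"
  defines "z \<equiv> 2 * cos t"
  shows "z ^ 3 - 0 * z ^ 2 + (-3) * z - (e::real) = 0"
  using two_cos_triple[of t] assms by simp

lemma cos_two_pi_thirds: "cos (2 * pi / 3) = - 1 / 2"
  using cos_double_cos[of "pi / 3"] by (simp add: cos_60 power2_eq_square)

section \<open>Symmetric functions of the cosine families in cases 2 and 3\<close>

abbreviation elementary_symmetric_3 :: "real \<Rightarrow> real \<Rightarrow> real \<Rightarrow> real \<times> real \<times> real" where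
  "elementary_symmetric_3 u v w \<equiv> (u + v + w, u * v + v * w + w * u, u * v * w)"

lemma two_cos_seventh_sym:
  "elementary_symmetric_3 (2 * cos (2 * pi / 7)) (2 * cos (4 * pi / 7)) (2 * cos (6 * pi / 7)) = (-1, -2, 1)"
  using viete_three[OF two_cos_seventh[of "2 * pi / 7" 1] two_cos_seventh[of "4 * pi / 7" 2]
      two_cos_seventh[of "6 * pi / 7" 3]]
  by (simp add: cos_ne_on_0_pi cos_ne_one)

text \<open>Tripling the three angles always gives cosine -1/2, so the doubled cosines are three
  distinct roots of z^3 - 3 z + 1.\<close>

lemma two_cos_ninth_sym:
  "elementary_symmetric_3 (2 * cos (2 * pi / 9)) (2 * cos (4 * pi / 9)) (2 * cos (8 * pi / 9)) = (0, -3, -1)"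
proof -
  have 1: "cos (4 * pi / 3) = - 1 / 2"
    using cos_diff_two_pi_int[of 1 "2 * pi / 3"] cos_two_pi_thirds by (simp add: field_simps)
  have 2: "cos (8 * pi / 3) = - 1 / 2"
    using cos_add_two_pi_int[of 1 "2 * pi / 3"] cos_two_pi_thirds by (simp add: field_simps)
  show ?thesis
    using viete_three[OF two_cos_ninth[of "2 * pi / 9" "-1"] two_cos_ninth[of "4 * pi / 9" "-1"]
      two_cos_ninth[of "8 * pi / 9" "-1"]] 1 2
    by (simp add: cos_ne_on_0_pi cos_two_pi_thirds)
qed

lemma cos_pi_minus_eq: "y = pi - x \<Longrightarrow> cos y = - cos x"
  by simp

text \<open>The reflection of x to pi - x negates cosines and carries the family of sevenths to this
  one: e1 and e3 change sign, e2 stays. The families for 18 and 10 arise likewise from those for 9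
  and 5.\<close>

lemma two_cos_fourteenth_sym:
  "elementary_symmetric_3 (2 * cos (2 * pi / 14)) (2 * cos (6 * pi / 14)) (2 * cos (10 * pi / 14)) = (1, -2, -1)"
proof -
  have "cos (2 * pi / 14) = - cos (6 * pi / 7)" "cos (6 * pi / 14) = - cos (4 * pi / 7)"
    "cos (10 * pi / 14) = - cos (2 * pi / 7)"
    by (rule cos_pi_minus_eq; simp add: field_simps)+
  then show ?thesis using two_cos_seventh_sym by (simp add: algebra_simps)
qed

lemma two_cos_eighteenth_sym:
  "elementary_symmetric_3 (2 * cos (2 * pi / 18)) (2 * cos (10 * pi / 18)) (2 * cos (14 * pi / 18)) = (0, -3, 1)"
proof -
  have "cos (2 * pi / 18) = - cos (8 * pi / 9)" "cos (10 * pi / 18) = - cos (4 * pi / 9)"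
    "cos (14 * pi / 18) = - cos (2 * pi / 9)"
    by (rule cos_pi_minus_eq; simp add: field_simps)+
  then show ?thesis using two_cos_ninth_sym by (simp add: algebra_simps)
qed

abbreviation sum_prod :: "real \<Rightarrow> real \<Rightarrow> real \<times> real" where
  "sum_prod u v \<equiv> (u + v, u * v)"

lemma two_cos_fifth_sym: "sum_prod (2 * cos (2 * pi / 5)) (2 * cos (4 * pi / 5)) = (-1, -1)"
  using viete_two[OF two_cos_fifth[of "2 * pi / 5" 1] two_cos_fifth[of "4 * pi / 5" 2]]
  by (simp add: cos_ne_on_0_pi cos_ne_one)

lemma two_cos_tenth_sym: "sum_prod (2 * cos (pi / 5)) (2 * cos (3 * pi / 5)) = (1, -1)"
proof -
  have "cos (pi / 5) = - cos (4 * pi / 5)" "cos (3 * pi / 5) = - cos (2 * pi / 5)"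
    by (rule cos_pi_minus_eq; simp add: field_simps)+
  then show ?thesis using two_cos_fifth_sym by (simp add: algebra_simps)
qed

lemma two_cos_eighth_sym: "sum_prod (2 * cos (pi / 4)) (2 * cos (3 * pi / 4)) = (0, -2)"
proof -
  have "cos (3 * pi / 4) = - cos (pi / 4)" by (rule cos_pi_minus_eq) (simp add: field_simps)
  then show ?thesis by (simp add: cos_45)
qed

lemma two_cos_twelfth_sym: "sum_prod (2 * cos (pi / 6)) (2 * cos (5 * pi / 6)) = (0, -3)"
proof -
  have "cos (5 * pi / 6) = - cos (pi / 6)" by (rule cos_pi_minus_eq) (simp add: field_simps)
  then show ?thesis by (simp add: cos_30)
qed

text \<open>The base angles realise exactly the integers in [-2, 2], so \<open>case1\<close>
  corresponds to three integral doubled cosines.\<close>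

lemma two_cos_base_angles: "(\<lambda>x. 2 * cos x) ` base_angles = {2, -2, -1, 0, 1}"
  by (simp add: base_angles_def cos_two_pi_thirds cos_60)

section \<open>Integer triples in [-2, 2]\<close>

text \<open>Finite search over the possible coefficients. Constraints free of \<open>e3\<close> come
  first, so a failing pair needs no search over \<open>e3\<close>; the last constraint is the
  discriminant. The cubics without an integer root in [-2, 2] belong, in order, to the families for
  7, 9, 14 and 18.\<close>

lemma cubic_int_enum:
  "\<forall>e1\<in>set [-6..6]. \<forall>e2\<in>set [-12..12::int]. 0 \<le> 12 - 4*e1 + e2 \<longrightarrow> 0 \<le> 12 + 4*e1 + e2 \<longrightarrow>
     3*e2 \<le> e1*e1 \<longrightarrow> (\<forall>e3\<in>set [-8..8::int].
     0 \<le> 8 - 4*e1 + 2*e2 - e3 \<longrightarrow> 0 \<le> 8 + 4*e1 + 2*e2 + e3 \<longrightarrow>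
     0 \<le> e1*e1*e2*e2 - 4*e2*e2*e2 - 4*e1*e1*e1*e3 + 18*e1*e2*e3 - 27*e3*e3 \<longrightarrow>
     list_ex (\<lambda>k. k*k*k - e1*k*k + e2*k - e3 = 0) [-2,-1,0,1,2] \<or>
     (e1,e2,e3) \<in> set [(-1,-2,1),(0,-3,-1),(1,-2,-1),(0,-3,1)])"
  by code_simp

text \<open>The quadratic analogue; the exceptional pairs belong, in order, to the families for 5,
  8, 10 and 12.\<close>

lemma quadratic_int_enum:
  "\<forall>p\<in>set [-4..4]. \<forall>q\<in>set [-4..4::int]. 0 \<le> 4 - 2*p + q \<longrightarrow> 0 \<le> 4 + 2*p + q \<longrightarrow>
     4*q \<le> p*p \<longrightarrow> list_ex (\<lambda>k. k*k - p*k + q = 0) [-2,-1,0,1,2] \<or>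
     (p,q) \<in> set [(-1,-1),(0,-2),(1,-1),(0,-3)]"
  by code_simp

text \<open>The three cases in terms of doubled cosines, in a fixed order; permutations are
  expressed separately through \<open>mset\<close>.\<close>

definition listed_cosines :: "real \<Rightarrow> real \<Rightarrow> real \<Rightarrow> bool" where
  "listed_cosines u v w \<longleftrightarrow> (\<exists>x y z. u = 2 * cos x \<and> v = 2 * cos y \<and> w = 2 * cos z \<and>
     (case1 x y z \<or> case2 x y z \<or> case3 x y z))"

lemma abs_int_bound_of_real: "\<lbrakk>u = real_of_int k; \<bar>u\<bar> \<le> of_int n\<rbrakk> \<Longrightarrow> -n \<le> k \<and> k \<le> n"
  by (simp add: abs_le_iff flip: of_int_minus)

section \<open>From integral symmetric functions to the listed cosines\<close>

lemma base_angle_exists: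
  assumes "u = of_int k" "\<bar>u\<bar> \<le> 2"
  obtains x where "x \<in> base_angles" "2 * cos x = u"
proof -
  have "k \<in> {-2..2}" using abs_int_bound_of_real[OF assms(1), of 2] assms(2) by simp
  then have "k \<in> {-2, -1, 0, 1, 2}" by auto
  then have "u \<in> (\<lambda>x. 2 * cos x) ` base_angles" unfolding two_cos_base_angles using assms by auto
  then show ?thesis using that by force
qed

lemma pair_classification:
  fixes u v w :: real
  assumes b: "\<bar>v\<bar> \<le> 2" "\<bar>w\<bar> \<le> 2" and int: "v + w = of_int p" "v * w = of_int q"
    and u: "u = of_int k" "\<bar>u\<bar> \<le> 2"
  shows "\<exists>v' w'. mset [v', w'] = mset [v, w] \<and> listed_cosines u v' w'"
proof -
  obtain x where x: "x \<in> base_angles" "2 * cos x = u" using base_angle_exists u by metis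
  have "\<bar>v + w\<bar> \<le> 4" using b by linarith
  then have p: "p \<in> set [-4..4]" unfolding set_upto using abs_int_bound_of_real[OF int(1), of 4] by simp
  have "\<bar>v\<bar> * \<bar>w\<bar> \<le> 2 * 2" using b by (intro mult_mono) auto
  then have "\<bar>v * w\<bar> \<le> 4" by (simp add: abs_mult)
  then have q: "q \<in> set [-4..4]" unfolding set_upto using abs_int_bound_of_real[OF int(2), of 4] by simp
  have "0 \<le> (2 - v) * (2 - w)" "0 \<le> (2 + v) * (2 + w)" "0 \<le> (v - w)\<^sup>2" using b by auto
  then have "0 \<le> 4 - 2 * (v + w) + v * w" "0 \<le> 4 + 2 * (v + w) + v * w"
    "4 * (v * w) \<le> (v + w) * (v + w)"
    by (simp_all add: power2_eq_square algebra_simps)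
  then have "real_of_int 0 \<le> of_int (4 - 2 * p + q)" "real_of_int 0 \<le> of_int (4 + 2 * p + q)"
    "real_of_int (4 * q) \<le> of_int (p * p)"
    unfolding int by simp_all
  then have "0 \<le> 4 - 2 * p + q" "0 \<le> 4 + 2 * p + q" "4 * q \<le> p * p"
    unfolding of_int_le_iff .
  then have "list_ex (\<lambda>k. k * k - p * k + q = 0) [-2,-1,0,1,2] \<or>
     (p, q) \<in> set [(-1,-1),(0,-2),(1,-1),(0,-3)]"
    using quadratic_int_enum p q by blast
  then consider j where "j * j - p * j + q = 0"
    | "(p, q) \<in> {(-1, -1), (0, -2), (1, -1), (0, -3)}"
    unfolding list_ex_iff list.set by blast
  then show ?thesis
  proof cases
    case 1
    \<comment> \<open>An integer root \<open>j\<close> must be \<open>v\<close> or \<open>w\<close>,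
      and the other one is then \<open>p - j\<close>. Both are integers, which leads to
      \<open>case1\<close>.\<close>
    have "(of_int j - v) * (of_int j - w) = of_int j * of_int j - (v + w) * of_int j + v * w"
      by (simp add: algebra_simps)
    also have "\<dots> = of_int (j * j - p * j + q)" using int by simp
    finally have "v = of_int j \<or> w = of_int j" using 1 by auto
    then have v: "(v = of_int j \<and> w = of_int (p - j)) \<or> (w = of_int j \<and> v = of_int (p - j))"
      using int by auto
    then obtain i l where "v = of_int i" "w = of_int l" by blast
    then obtain y z where "y \<in> base_angles" "2 * cos y = v" "z \<in> base_angles" "2 * cos z = w"
      using base_angle_exists b by metis
    then have "listed_cosines u v w" unfolding listed_cosines_def case1_def using x by blast
    then show ?thesis by blast
  next
    case 2
    have *: ?thesis if "case2 x y z" "sum_prod (2 * cos y) (2 * cos z) = (of_int p, of_int q)" for y z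
    proof -
      have "listed_cosines u (2 * cos y) (2 * cos z)" unfolding listed_cosines_def using that x by blast
      moreover have "mset [2 * cos y, 2 * cos z] = mset [v, w]"
        by (rule mset_pair_eq_of_sum_prod) (use that int in auto)
      ultimately show ?thesis by blast
    qed
    from 2 consider "p = -1" "q = -1" | "p = 0" "q = -2" | "p = 1" "q = -1" | "p = 0" "q = -3" by auto
    then show ?thesis
    proof cases
      \<comment> \<open>\<open>[THEN trans]\<close> leaves only the comparison of the literal pair
        with \<open>(of_int p, of_int q)\<close>, which the values of \<open>p\<close> and
        \<open>q\<close> settle.\<close>
      case 1 then show ?thesis using *[OF _ two_cos_fifth_sym[THEN trans]] x by (simp add: case2_def)
    next
      case 2 then show ?thesis using *[OF _ two_cos_eighth_sym[THEN trans]] x by (simp add: case2_def)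
    next
      case 3 then show ?thesis using *[OF _ two_cos_tenth_sym[THEN trans]] x by (simp add: case2_def)
    next
      case 4 then show ?thesis using *[OF _ two_cos_twelfth_sym[THEN trans]] x by (simp add: case2_def)
    qed
  qed
qed

text \<open>Dividing the cubic by its integer root \<open>k\<close> leaves an integer quadratic for
  \<open>v\<close> and \<open>w\<close>, with sum \<open>e1 - k\<close> and product
  \<open>e2 - k * (e1 - k)\<close>.\<close>

lemma triple_classification_of_integer_entry:
  fixes u v w :: real
  assumes b: "\<bar>u\<bar> \<le> 2" "\<bar>v\<bar> \<le> 2" "\<bar>w\<bar> \<le> 2"
    and int: "u + v + w = of_int e1" "u * v + v * w + w * u = of_int e2"
    and u: "u = of_int k"
  shows "\<exists>u' v' w'. mset [u', v', w'] = mset [u, v, w] \<and> listed_cosines u' v' w'"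
proof -
  have "v + w = of_int (e1 - k)" using int u by simp
  moreover have "v * w = of_int (e2 - k * (e1 - k))"
  proof -
    have "v * w = (u * v + v * w + w * u) - u * (u + v + w - u)" by (simp add: algebra_simps)
    then show ?thesis unfolding int unfolding u by simp
  qed
  ultimately obtain v' w' where "mset [v', w'] = mset [v, w]" "listed_cosines u v' w'"
    using pair_classification[OF b(2,3) _ _ u b(1)] by blast
  then show ?thesis by (intro exI[of _ u] exI[of _ v'] exI[of _ w']) simp
qed

lemma triple_classification:
  fixes u v w :: real
  assumes b: "\<bar>u\<bar> \<le> 2" "\<bar>v\<bar> \<le> 2" "\<bar>w\<bar> \<le> 2"
    and int: "u + v + w = of_int e1" "u * v + v * w + w * u = of_int e2" "u * v * w = of_int e3"
  shows "\<exists>u' v' w'. mset [u', v', w'] = mset [u, v, w] \<and> listed_cosines u' v' w'"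
proof -
  have "\<bar>u + v + w\<bar> \<le> 6" using b by linarith
  then have e1: "e1 \<in> set [-6..6]" unfolding set_upto using abs_int_bound_of_real[OF int(1), of 6] by simp
  have "\<bar>u\<bar> * \<bar>v\<bar> \<le> 2 * 2" "\<bar>v\<bar> * \<bar>w\<bar> \<le> 2 * 2" "\<bar>w\<bar> * \<bar>u\<bar> \<le> 2 * 2"
    using mult_mono[OF b(1,2)] mult_mono[OF b(2,3)] mult_mono[OF b(3,1)] by simp_all
  then have uv: "\<bar>u * v\<bar> \<le> 4" "\<bar>v * w\<bar> \<le> 4" "\<bar>w * u\<bar> \<le> 4" by (simp_all add: abs_mult)
  then have "\<bar>u * v + v * w + w * u\<bar> \<le> 12" by linarith
  then have e2: "e2 \<in> set [-12..12]" unfolding set_upto using abs_int_bound_of_real[OF int(2), of 12] by simp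
  have "\<bar>u * v\<bar> * \<bar>w\<bar> \<le> 4 * 2" using mult_mono[OF uv(1) b(3)] by simp
  then have "\<bar>u * v * w\<bar> \<le> 8" by (simp add: abs_mult)
  then have e3: "e3 \<in> set [-8..8]" unfolding set_upto using abs_int_bound_of_real[OF int(3), of 8] by simp
  \<comment> \<open>The inequalities are proved over the reals in terms of these names and then
    transferred to the integers \<open>e1\<close>, \<open>e2\<close>, \<open>e3\<close>.\<close>
  define E1 E2 E3 where E: "E1 = u + v + w" "E2 = u * v + v * w + w * u" "E3 = u * v * w"
  have "0 \<le> (2 - u) * (2 - v) + (2 - v) * (2 - w) + (2 - w) * (2 - u)" using b by (simp add: abs_le_iff)
  also have "\<dots> = 12 - 4 * E1 + E2" unfolding E by (simp add: algebra_simps)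
  finally have 1: "0 \<le> 12 - 4 * E1 + E2" .
  have "0 \<le> (2 + u) * (2 + v) + (2 + v) * (2 + w) + (2 + w) * (2 + u)" using b by (simp add: abs_le_iff)
  also have "\<dots> = 12 + 4 * E1 + E2" unfolding E by (simp add: algebra_simps)
  finally have 2: "0 \<le> 12 + 4 * E1 + E2" .
  have "0 \<le> (u - v)\<^sup>2 + (v - w)\<^sup>2 + (w - u)\<^sup>2" by simp
  also have "\<dots> = 2 * (E1 * E1 - 3 * E2)" unfolding E by (simp add: algebra_simps power2_eq_square)
  finally have 3: "3 * E2 \<le> E1 * E1" by simp
  have "0 \<le> (2 - u) * (2 - v) * (2 - w)" using b by (simp add: abs_le_iff)
  also have "\<dots> = 8 - 4 * E1 + 2 * E2 - E3" unfolding E by (simp add: algebra_simps)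
  finally have 4: "0 \<le> 8 - 4 * E1 + 2 * E2 - E3" .
  have "0 \<le> (2 + u) * (2 + v) * (2 + w)" using b by (simp add: abs_le_iff)
  also have "\<dots> = 8 + 4 * E1 + 2 * E2 + E3" unfolding E by (simp add: algebra_simps)
  finally have 5: "0 \<le> 8 + 4 * E1 + 2 * E2 + E3" .
  \<comment> \<open>The discriminant of the cubic with real roots \<open>u\<close>,
    \<open>v\<close>, \<open>w\<close>, rewritten in its coefficients.\<close>
  have "0 \<le> ((u - v) * (v - w) * (w - u))\<^sup>2" by simp
  also have "\<dots> = E1 * E1 * E2 * E2 - 4 * E2 * E2 * E2 - 4 * E1 * E1 * E1 * E3 + 18 * E1 * E2 * E3 - 27 * E3 * E3"
    unfolding E by Groebner_Basis.algebra
  finally have 6: "0 \<le> E1 * E1 * E2 * E2 - 4 * E2 * E2 * E2 - 4 * E1 * E1 * E1 * E3 + 18 * E1 * E2 * E3 - 27 * E3 * E3" .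
  have Ei: "E1 = of_int e1" "E2 = of_int e2" "E3 = of_int e3" using E int by auto
  have "real_of_int 0 \<le> of_int (12 - 4 * e1 + e2)" "real_of_int 0 \<le> of_int (12 + 4 * e1 + e2)"
    "real_of_int (3 * e2) \<le> of_int (e1 * e1)"
    "real_of_int 0 \<le> of_int (8 - 4 * e1 + 2 * e2 - e3)" "real_of_int 0 \<le> of_int (8 + 4 * e1 + 2 * e2 + e3)"
    "real_of_int 0 \<le> of_int (e1 * e1 * e2 * e2 - 4 * e2 * e2 * e2 - 4 * e1 * e1 * e1 * e3 + 18 * e1 * e2 * e3 - 27 * e3 * e3)"
    using 1 2 3 4 5 6 unfolding Ei by simp_all
  note ineqs = this[unfolded of_int_le_iff]
  have "list_ex (\<lambda>k. k * k * k - e1 * k * k + e2 * k - e3 = 0) [-2,-1,0,1,2] \<or>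
     (e1, e2, e3) \<in> set [(-1,-2,1),(0,-3,-1),(1,-2,-1),(0,-3,1)]"
    using cubic_int_enum e1 e2 e3 ineqs by blast
  then consider k where "k * k * k - e1 * k * k + e2 * k - e3 = 0"
    | "(e1, e2, e3) \<in> {(-1, -2, 1), (0, -3, -1), (1, -2, -1), (0, -3, 1)}"
    unfolding list_ex_iff list.set by blast
  then show ?thesis
  proof cases
    case 1
    have "(of_int k - u) * (of_int k - v) * (of_int k - w) =
        of_int k * of_int k * of_int k - E1 * of_int k * of_int k + E2 * of_int k - E3"
      unfolding E by (simp add: algebra_simps)
    also have "\<dots> = of_int (k * k * k - e1 * k * k + e2 * k - e3)" unfolding Ei by simp
    finally consider "u = of_int k" | "v = of_int k" | "w = of_int k" using 1 by auto
    then show ?thesis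
    proof cases
      case 1
      then show ?thesis using triple_classification_of_integer_entry b int by blast
    next
      case 2
      \<comment> \<open>The hypotheses are cyclically symmetric, so rotating the triple brings the
        integer entry to the front.\<close>
      have "v + w + u = of_int e1" "v * w + w * u + u * v = of_int e2" using int by (simp_all add: add_ac)
      from triple_classification_of_integer_entry[OF b(2,3,1) this 2] show ?thesis
        by (simp add: add_mset_commute)
    next
      case 3
      have "w + u + v = of_int e1" "w * u + u * v + v * w = of_int e2" using int by (simp_all add: add_ac)
      from triple_classification_of_integer_entry[OF b(3,1,2) this 3] show ?thesis
        by (simp add: add_mset_commute)
    qed
  next
    case 2
    have *: ?thesis if "case3 x y z"
      "elementary_symmetric_3 (2 * cos x) (2 * cos y) (2 * cos z) = (of_int e1, of_int e2, of_int e3)" for x y z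
    proof -
      have "listed_cosines (2 * cos x) (2 * cos y) (2 * cos z)" unfolding listed_cosines_def using that by blast
      moreover have "mset [2 * cos x, 2 * cos y, 2 * cos z] = mset [u, v, w]"
        by (rule mset_triple_eq_of_elementary_symmetric) (use that int in auto)
      ultimately show ?thesis by blast
    qed
    from 2 consider "e1 = -1" "e2 = -2" "e3 = 1" | "e1 = 0" "e2 = -3" "e3 = -1"
      | "e1 = 1" "e2 = -2" "e3 = -1" | "e1 = 0" "e2 = -3" "e3 = 1" by auto
    then show ?thesis
    proof cases
      case 1 then show ?thesis using *[OF _ two_cos_seventh_sym[THEN trans]] by (simp add: case3_def)
    next
      case 2 then show ?thesis using *[OF _ two_cos_ninth_sym[THEN trans]] by (simp add: case3_def)
    next
      case 3 then show ?thesis using *[OF _ two_cos_fourteenth_sym[THEN trans]] by (simp add: case3_def)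
    next
      case 4 then show ?thesis using *[OF _ two_cos_eighteenth_sym[THEN trans]] by (simp add: case3_def)
    qed
  qed
qed

section \<open>The classification\<close>

text \<open>The classification permutes cosines, whereas the theorem permutes \<open>a\<close>,
  \<open>b\<close>, \<open>c\<close>. Each entry of \<open>ys\<close> is matched with one preimage
  in \<open>xs\<close>, which is then removed, so coinciding values of \<open>f\<close> do no
  harm.\<close>

lemma mset_map_lift:
  "mset ys = mset (map f xs) \<Longrightarrow> \<exists>zs. mset zs = mset xs \<and> ys = map f zs"
proof (induction ys arbitrary: xs)
  case (Cons y ys)
  then have "y \<in># mset (map f xs)" by (metis list.set_intros(1) set_mset_mset)
  then obtain x where x: "x \<in> set xs" "y = f x" by auto
  then obtain xs1 xs2 where xs: "xs = xs1 @ x # xs2" by (meson split_list)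
  then have "mset ys = mset (map f (xs1 @ xs2))" using Cons.prems x by simp
  from Cons.IH[OF this] obtain zs where "mset zs = mset (xs1 @ xs2)" "ys = map f zs" by blast
  then show ?case using x xs by (intro exI[of _ "x # zs"]) simp
qed simp

lemma sin_ne_zero_of_cos_eq:
  assumes "cos \<theta> = cos x" "0 < x" "x < pi"
  shows "sin \<theta> \<noteq> 0"
proof -
  have "(sin \<theta>)\<^sup>2 = (sin x)\<^sup>2" using assms(1) by (simp add: sin_squared_eq)
  then show ?thesis using sin_gt_zero[OF assms(2,3)] by auto
qed

section \<open>Integer models for the listed angles\<close>

lemma integer_companion2: "u \<in> \<int> \<Longrightarrow> integer_mat (companion2 u)"
  by (rule integer_matI) (auto simp: companion2_def mat_of_rows_list_def numeral_eq_Suc less_Suc_eq)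

lemma integer_companion4: "p \<in> \<int> \<Longrightarrow> q \<in> \<int> \<Longrightarrow> integer_mat (companion4 p q)"
  by (rule integer_matI) (auto simp: companion4_def mat_of_rows_list_def numeral_eq_Suc less_Suc_eq)

lemma integer_companion6: "p \<in> \<int> \<Longrightarrow> q \<in> \<int> \<Longrightarrow> r \<in> \<int> \<Longrightarrow> integer_mat (companion6 p q r)"
  by (rule integer_matI) (auto simp: companion6_def mat_of_rows_list_def numeral_eq_Suc less_Suc_eq)

text \<open>If the sine vanishes, the rotation is plus or minus the identity, which is already
  integral but not similar to a companion matrix; otherwise \<open>companion2\<close> works.\<close>

lemma rot_mat_similar_integer:
  assumes "2 * cos \<theta> \<in> \<int>"
  shows "\<exists>N. integer_mat N \<and> similar_mat (rot_mat \<theta>) N"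
proof (cases "sin \<theta> = 0")
  case True
  then have "cos \<theta> \<in> {1, -1}" using sin_cos_squared_add[of \<theta>] by (auto simp: power2_eq_1_iff)
  then have "cos \<theta> \<in> \<int>" by auto
  then have "integer_mat (rot_mat \<theta>)" using True
    by (intro integer_matI) (auto simp: rot_mat_def mat_of_rows_list_def numeral_eq_Suc less_Suc_eq)
  then show ?thesis using similar_mat_refl[OF rot_mat_carrier] by blast
next
  case False
  then show ?thesis using similar_rot_mat_companion2 integer_companion2 assms by blast
qed

lemma base_angle_integer:
  assumes "cos \<theta> = cos x" "x \<in> base_angles"
  shows "2 * cos \<theta> \<in> \<int>"
proof -
  have "2 * cos \<theta> \<in> (\<lambda>x. 2 * cos x) ` base_angles" using assms by auto
  then show ?thesis unfolding two_cos_base_angles by auto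
qed

lemma similar_mat_diag_block_nil: "similar_mat (diag_block_mat []) (diag_block_mat [] :: 'a :: semiring_1 mat)"
  using similar_mat_refl[of "0\<^sub>m 0 0 :: 'a mat" 0] by simp

text \<open>Each rotation becomes a \<open>companion2\<close> block, possibly with irrational entry.
  Merging the two blocks into \<open>companion4\<close> leaves only their sum and product, which are
  integers.\<close>

lemma rot_pair_similar_integer:
  assumes "2 * cos \<theta> + 2 * cos \<eta> \<in> \<int>" "(2 * cos \<theta>) * (2 * cos \<eta>) \<in> \<int>" "cos \<theta> \<noteq> cos \<eta>"
    "sin \<theta> \<noteq> 0" "sin \<eta> \<noteq> 0"
  shows "\<exists>N. integer_mat N \<and> similar_mat (diag_block_mat [rot_mat \<theta>, rot_mat \<eta>]) N"
proof (intro exI conjI)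
  show "integer_mat (companion4 (2 * cos \<theta> + 2 * cos \<eta>) ((2 * cos \<theta>) * (2 * cos \<eta>)))"
    by (rule integer_companion4[OF assms(1,2)])
  have "similar_mat (diag_block_mat [rot_mat \<theta>, rot_mat \<eta>])
      (diag_block_mat [companion2 (2 * cos \<theta>), companion2 (2 * cos \<eta>)])"
    by (intro similar_mat_diag_block_Cons similar_rot_mat_companion2 similar_mat_diag_block_nil assms)
  then show "similar_mat (diag_block_mat [rot_mat \<theta>, rot_mat \<eta>])
      (companion4 (2 * cos \<theta> + 2 * cos \<eta>) ((2 * cos \<theta>) * (2 * cos \<eta>)))"
    by (rule similar_mat_trans) (rule similar_diag_companion2_companion4, use assms in simp)
qed

lemma rot_triple_similar_integer:
  assumes "2 * cos \<theta> + 2 * cos \<eta> + 2 * cos \<zeta> \<in> \<int>"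
    "(2 * cos \<theta>) * (2 * cos \<eta>) + (2 * cos \<eta>) * (2 * cos \<zeta>) + (2 * cos \<zeta>) * (2 * cos \<theta>) \<in> \<int>"
    "(2 * cos \<theta>) * (2 * cos \<eta>) * (2 * cos \<zeta>) \<in> \<int>"
    "cos \<theta> \<noteq> cos \<eta>" "cos \<eta> \<noteq> cos \<zeta>" "cos \<zeta> \<noteq> cos \<theta>"
    "sin \<theta> \<noteq> 0" "sin \<eta> \<noteq> 0" "sin \<zeta> \<noteq> 0"
  shows "\<exists>N. integer_mat N \<and> similar_mat (diag_block_mat [rot_mat \<theta>, rot_mat \<eta>, rot_mat \<zeta>]) N"
proof (intro exI conjI)
  let ?N = "companion6 (2 * cos \<theta> + 2 * cos \<eta> + 2 * cos \<zeta>)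
    ((2 * cos \<theta>) * (2 * cos \<eta>) + (2 * cos \<eta>) * (2 * cos \<zeta>) + (2 * cos \<zeta>) * (2 * cos \<theta>))
    ((2 * cos \<theta>) * (2 * cos \<eta>) * (2 * cos \<zeta>))"
  show "integer_mat ?N" by (rule integer_companion6[OF assms(1-3)])
  have "similar_mat (diag_block_mat [rot_mat \<theta>, rot_mat \<eta>, rot_mat \<zeta>])
      (diag_block_mat [companion2 (2 * cos \<theta>), companion2 (2 * cos \<eta>), companion2 (2 * cos \<zeta>)])"
    by (intro similar_mat_diag_block_Cons similar_rot_mat_companion2 similar_mat_diag_block_nil assms)
  then show "similar_mat (diag_block_mat [rot_mat \<theta>, rot_mat \<eta>, rot_mat \<zeta>]) ?N"
    by (rule similar_mat_trans) (rule similar_diag_companion2_companion6, use assms in simp_all)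
qed

text \<open>Collects what the integer model needs. Since the angles lie strictly between 0 and pi,
  distinct angles have distinct cosines, and the sines are nonzero.\<close>

lemma case2_pair:
  assumes "case2 x y z"
  shows "sum_prod (2 * cos y) (2 * cos z) \<in> \<int> \<times> \<int>" "cos y \<noteq> cos z" "0 < y" "y < pi" "0 < z" "z < pi"
proof -
  from assms consider "y = 2 * pi / 5" "z = 4 * pi / 5" | "y = pi / 4" "z = 3 * pi / 4"
    | "y = pi / 5" "z = 3 * pi / 5" | "y = pi / 6" "z = 5 * pi / 6"
    unfolding case2_def by blast
  then have "sum_prod (2 * cos y) (2 * cos z) \<in> \<int> \<times> \<int> \<and>
    0 < y \<and> y < pi \<and> 0 < z \<and> z < pi \<and> y \<noteq> z"
  proof cases
    case 1 show ?thesis unfolding 1 two_cos_fifth_sym by simp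
  next
    case 2 show ?thesis unfolding 2 two_cos_eighth_sym by simp
  next
    case 3 show ?thesis unfolding 3 two_cos_tenth_sym by simp
  next
    case 4 show ?thesis unfolding 4 two_cos_twelfth_sym by simp
  qed
  then show "sum_prod (2 * cos y) (2 * cos z) \<in> \<int> \<times> \<int>" "cos y \<noteq> cos z"
    "0 < y" "y < pi" "0 < z" "z < pi"
    using cos_ne_on_0_pi[of y z] by auto
qed

lemma case3_triple:
  assumes "case3 x y z"
  shows "elementary_symmetric_3 (2 * cos x) (2 * cos y) (2 * cos z) \<in> \<int> \<times> \<int> \<times> \<int>"
    "cos x \<noteq> cos y" "cos y \<noteq> cos z" "cos z \<noteq> cos x"
    "0 < x" "x < pi" "0 < y" "y < pi" "0 < z" "z < pi"
proof -
  from assms consider "x = 2 * pi / 7" "y = 4 * pi / 7" "z = 6 * pi / 7"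
    | "x = 2 * pi / 9" "y = 4 * pi / 9" "z = 8 * pi / 9"
    | "x = 2 * pi / 14" "y = 6 * pi / 14" "z = 10 * pi / 14"
    | "x = 2 * pi / 18" "y = 10 * pi / 18" "z = 14 * pi / 18"
    unfolding case3_def by blast
  then have "elementary_symmetric_3 (2 * cos x) (2 * cos y) (2 * cos z) \<in> \<int> \<times> \<int> \<times> \<int> \<and>
    0 < x \<and> x < pi \<and> 0 < y \<and> y < pi \<and> 0 < z \<and> z < pi \<and> x \<noteq> y \<and> y \<noteq> z \<and> z \<noteq> x"
  proof cases
    case 1 show ?thesis unfolding 1 two_cos_seventh_sym by simp
  next
    case 2 show ?thesis unfolding 2 two_cos_ninth_sym by simp
  next
    case 3 show ?thesis unfolding 3 two_cos_fourteenth_sym by simp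
  next
    case 4 show ?thesis unfolding 4 two_cos_eighteenth_sym by simp
  qed
  then show "elementary_symmetric_3 (2 * cos x) (2 * cos y) (2 * cos z) \<in> \<int> \<times> \<int> \<times> \<int>"
    "cos x \<noteq> cos y" "cos y \<noteq> cos z" "cos z \<noteq> cos x"
    "0 < x" "x < pi" "0 < y" "y < pi" "0 < z" "z < pi"
    using cos_ne_on_0_pi[of x y] cos_ne_on_0_pi[of y z] cos_ne_on_0_pi[of z x] by auto
qed

text \<open>The three cases use integer blocks of sizes 2 + 2 + 2, 2 + 4 and 6 respectively.\<close>

lemma phi_similar_integer:
  assumes cos: "cos (a * t) = cos x" "cos (b * t) = cos y" "cos (c * t) = cos z"
    and "case1 x y z \<or> case2 x y z \<or> case3 x y z"
  shows "\<exists>B. integer_mat B \<and> similar_mat (phi a b c t) B"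
  using assms(4)
proof (elim disjE)
  assume "case1 x y z"
  then have "2 * cos (a * t) \<in> \<int>" "2 * cos (b * t) \<in> \<int>" "2 * cos (c * t) \<in> \<int>"
    using base_angle_integer cos unfolding case1_def by blast+
  then obtain K L M where "integer_mat K" "similar_mat (rot_mat (a * t)) K"
    "integer_mat L" "similar_mat (rot_mat (b * t)) L" "integer_mat M" "similar_mat (rot_mat (c * t)) M"
    using rot_mat_similar_integer by metis
  then have "integer_mat (diag_block_mat [K, L, M])" "similar_mat (phi a b c t) (diag_block_mat [K, L, M])"
    unfolding phi_def
    \<comment> \<open>The unfolding rules for \<open>diag_block_mat\<close> are switched off so that
      the list of blocks stays visible to the introduction rules.\<close>
    by (auto intro!: integer_diag_block_mat similar_mat_diag_block_Cons similar_mat_diag_block_nil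
        simp del: diag_block_mat.simps diag_block_mat_singleton)
  then show ?thesis by blast
next
  assume c2: "case2 x y z"
  note p = case2_pair[OF c2]
  have "2 * cos (a * t) \<in> \<int>" using base_angle_integer[OF cos(1)] c2 by (simp add: case2_def)
  then obtain K where K: "integer_mat K" "similar_mat (rot_mat (a * t)) K"
    using rot_mat_similar_integer by blast
  obtain N where N: "integer_mat N" "similar_mat (diag_block_mat [rot_mat (b * t), rot_mat (c * t)]) N"
    using rot_pair_similar_integer[of "b * t" "c * t"] p
      sin_ne_zero_of_cos_eq[OF cos(2) p(3,4)] sin_ne_zero_of_cos_eq[OF cos(3) p(5,6)]
    unfolding cos by auto
  \<comment> \<open>\<open>N\<close> is read as the one-block matrix
    \<open>diag_block_mat [N]\<close>, so that the last two rotations can be replaced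
    together.\<close>
  have "similar_mat (phi a b c t) (diag_block_mat [K, N])"
    unfolding phi_def using similar_mat_diag_block_Cons[OF K(2), of _ "[N]"] N(2)
    by (simp only: diag_block_mat_singleton)
  moreover have "integer_mat (diag_block_mat [K, N])"
    using K N by (intro integer_diag_block_mat) auto
  ultimately show ?thesis by blast
next
  assume "case3 x y z"
  note p = case3_triple[OF this]
  show ?thesis unfolding phi_def
    using rot_triple_similar_integer[of "a * t" "b * t" "c * t"] p
      sin_ne_zero_of_cos_eq[OF cos(1) p(5,6)] sin_ne_zero_of_cos_eq[OF cos(2) p(7,8)]
      sin_ne_zero_of_cos_eq[OF cos(3) p(9,10)]
    unfolding cos by (simp only: mem_Times_iff fst_conv snd_conv) blast
qed

lemma phi_similar_permuted:
  assumes "mset [a', b', c'] = mset [a, b, c]"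
  shows "similar_mat (phi a b c t) (phi a' b' c' t)"
proof -
  let ?R = "\<lambda>s. rot_mat (s * t)"
  have "image_mset ?R (mset [a, b, c]) = image_mset ?R (mset [a', b', c'])" using assms by simp
  then have "mset (map ?R [a, b, c]) = mset (map ?R [a', b', c'])" by (simp only: mset_map)
  then have "similar_mat (diag_block_mat (map ?R [a, b, c])) (diag_block_mat (map ?R [a', b', c']))"
    by (rule similar_mat_diag_block_mset) (auto simp: carrier_matD[OF rot_mat_carrier])
  then show ?thesis unfolding phi_def list.map .
qed

theorem theorem3p1:
  fixes a b c t0 :: real
  assumes "a\<^sup>2 + b\<^sup>2 + c\<^sup>2 \<noteq> 0"
  shows "(\<exists>B. integer_mat B \<and> similar_mat (phi a b c t0) B) \<longleftrightarrow>
    (\<exists>a' b' c' x y z. mset [a', b', c'] = mset [a, b, c] \<and>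
       angle_replacement (a' * t0) x \<and> angle_replacement (b' * t0) y \<and>
       angle_replacement (c' * t0) z \<and>
       (case1 x y z \<or> case2 x y z \<or> case3 x y z))"
proof
  assume "\<exists>B. integer_mat B \<and> similar_mat (phi a b c t0) B"
  then obtain B where B: "similar_mat (phi a b c t0) B" "integer_mat B" by blast
  let ?u = "\<lambda>s. 2 * cos (s * t0)"
  have bound: "\<bar>?u s\<bar> \<le> 2" for s by (simp add: abs_mult)
  obtain e1 e2 e3 where "?u a + ?u b + ?u c = of_int e1"
    "?u a * ?u b + ?u b * ?u c + ?u c * ?u a = of_int e2" "?u a * ?u b * ?u c = of_int e3"
    using similar_integer_imp_symmetric_integers[OF B] by (elim Ints_cases)
  from triple_classification[OF bound bound bound this]
  obtain u v w where "mset [u, v, w] = mset [?u a, ?u b, ?u c]" and g: "listed_cosines u v w" by blast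
  then have "mset [u, v, w] = mset (map ?u [a, b, c])" by (simp only: list.map)
  from mset_map_lift[OF this] obtain zs where zs: "mset zs = mset [a, b, c]" "[u, v, w] = map ?u zs"
    by (elim exE conjE)
  from zs(2) obtain a' b' c' where abc: "zs = [a', b', c']" "u = ?u a'" "v = ?u b'" "w = ?u c'"
    by (auto simp: Cons_eq_map_conv)
  from g obtain x y z where "?u a' = 2 * cos x" "?u b' = 2 * cos y" "?u c' = 2 * cos z"
    and cases: "case1 x y z \<or> case2 x y z \<or> case3 x y z"
    unfolding listed_cosines_def abc by blast
  then have "cos (a' * t0) = cos x" "cos (b' * t0) = cos y" "cos (c' * t0) = cos z" by simp_all
  with zs(1) cases show "\<exists>a' b' c' x y z. mset [a', b', c'] = mset [a, b, c] \<and>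
       angle_replacement (a' * t0) x \<and> angle_replacement (b' * t0) y \<and>
       angle_replacement (c' * t0) z \<and>
       (case1 x y z \<or> case2 x y z \<or> case3 x y z)"
    unfolding angle_replacement_iff_cos_eq abc(1) by blast
next
  assume "\<exists>a' b' c' x y z. mset [a', b', c'] = mset [a, b, c] \<and>
       angle_replacement (a' * t0) x \<and> angle_replacement (b' * t0) y \<and>
       angle_replacement (c' * t0) z \<and>
       (case1 x y z \<or> case2 x y z \<or> case3 x y z)"
  then obtain a' b' c' x y z where m: "mset [a', b', c'] = mset [a, b, c]"
    and "cos (a' * t0) = cos x" "cos (b' * t0) = cos y" "cos (c' * t0) = cos z"
    and "case1 x y z \<or> case2 x y z \<or> case3 x y z"
    unfolding angle_replacement_iff_cos_eq by blast
  from phi_similar_integer[OF this(2-)] obtain B where "integer_mat B" "similar_mat (phi a' b' c' t0) B"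
    by blast
  then show "\<exists>B. integer_mat B \<and> similar_mat (phi a b c t0) B"
    using similar_mat_trans[OF phi_similar_permuted[OF m]] by blast
qed

end
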